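(* Let $\lambda$ be an arbitrary infinite cardinal and let $A\subseteq\lambda$ be an arbitrary infinite subset. Let $\tau_{\mathsf{fc}}^2$ be the topology on $\exp_2\lambda$ determined by $A$ as described in the context. Then $(\exp_2\lambda,\tau_{\mathsf{fc}}^2)$ is a countably pracompact semitopological semilattice such that $(\exp_2\lambda,\tau_{\mathsf{fc}}^2)$ is an $H$-closed non-semiregular space.
   Context: $\exp_2\lambda=\{C\subseteq\lambda : |C|\leqslant 2\}$, regarded as a semilattice with operation $\cap$; its zero is $0=\varnothing$. For $x\in\exp_2\lambda$ put ${\uparrow}x=\{y\in\exp_2\lambda : x\subseteq y\}$. A semitopological semilattice is a topological space together with a separately continuous semilattice operation. For $x\in\exp_2\lambda$ let $\mathscr{B}_{\mathsf{c}}^2(x)$ be the family of all sets ${\uparrow}x\setminus({\uparrow}x_1\cup\cdots\cup{\uparrow}x_j)$, where $x_1,\ldots,x_j$ is a finite (possibly empty) list of elements of ${\uparrow}x\setminus\{x\}$. Let $\pi\colon\lambda\to\exp_2\lambda$, $\pi(a)=\{a\}$. Given the fixed infinite subset $A\subseteq\lambda$, the topology $\tau_{\mathsf{fc}}^2$ on $\exp_2\lambda$ is the (Hausdorff) topology with the following neighbourhood bases: at each non-zero $x\in\exp_2\lambda$ the base is $\mathscr{B}_{\mathsf{fc}}^2(x)=\mathscr{B}_{\mathsf{c}}^2(x)$, and at $0$ the base is $$\mathscr{B}_{\mathsf{fc}}^2(0)=\{U(0)\setminus\pi(B) : U(0)\in\mathscr{B}_{\mathsf{c}}^2(0),\ B\subseteq\lambda,\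 \text{and } (A\setminus B)\cup(B\setminus A)\text{ is finite}\}.$$ A space $X$ is countably pracompact if there is a dense subset $D\subseteq X$ such that every infinite subset of $D$ has an accumulation point in $X$. A (Hausdorff) space $X$ is $H$-closed if it is a closed subspace of every Hausdorff topological space in which it is contained as a subspace. A space is semiregular if it has a base consisting of regular open sets, i.e. sets $W$ with $\operatorname{int}_X(\operatorname{cl}_X(W))=W$; non-semiregular means not semiregular. *)

theory Defs
  imports "HOL-Analysis.Analysis"
begin

text \<open>The cardinal \<open>\<lambda>\<close> is represented by an arbitrary infinite set \<open>L\<close>; only its
  cardinality matters.\<close>

definition exp2 :: "'a set \<Rightarrow> 'a set set" where
  "exp2 L = {C. C \<subseteq> L \<and> finite C \<and> card C \<le> 2}"

definition up :: "'a set \<Rightarrow> 'a set \<Rightarrow> 'a set set" where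
  "up L x = {y \<in> exp2 L. x \<subseteq> y}"

definition base_c :: "'a set \<Rightarrow> 'a set \<Rightarrow> 'a set set set" where
  "base_c L x = {up L x - (\<Union>y\<in>F. up L y) | F. finite F \<and> F \<subseteq> up L x - {x}}"

definition base_fc :: "'a set \<Rightarrow> 'a set \<Rightarrow> 'a set \<Rightarrow> 'a set set set" where
  "base_fc L A x =
     (if x = {}
      then {U - (\<lambda>a. {a}) ` B | U B. U \<in> base_c L {} \<and> B \<subseteq> L \<and> finite ((A - B) \<union> (B - A))}
      else base_c L x)"

text \<open>\<open>topology\<close> is only meaningful on predicates satisfying \<open>istopology\<close>. The lemmas
  \<open>openin_tau_fc\<close>, \<open>base_fc_open\<close> and \<open>base_fc_neighbourhood_base\<close> below show that this is the
  case and that \<open>base_fc L A x\<close> is an (open) neighbourhood base at \<open>x\<close>.\<close>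

definition tau_fc :: "'a set \<Rightarrow> 'a set \<Rightarrow> 'a set topology" where
  "tau_fc L A = topology (\<lambda>U. U \<subseteq> exp2 L \<and> (\<forall>x\<in>U. \<exists>V\<in>base_fc L A x. V \<subseteq> U))"

definition semitopological_semilattice :: "'a topology \<Rightarrow> ('a \<Rightarrow> 'a \<Rightarrow> 'a) \<Rightarrow> bool" where
  "semitopological_semilattice X m \<longleftrightarrow>
     (\<forall>x\<in>topspace X. \<forall>y\<in>topspace X. m x y \<in> topspace X) \<and>
     (\<forall>x\<in>topspace X. \<forall>y\<in>topspace X. \<forall>z\<in>topspace X. m (m x y) z = m x (m y z)) \<and>
     (\<forall>x\<in>topspace X. \<forall>y\<in>topspace X. m x y = m y x) \<and>
     (\<forall>x\<in>topspace X. m x x = x) \<and>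
     (\<forall>a\<in>topspace X. continuous_map X X (\<lambda>x. m a x) \<and> continuous_map X X (\<lambda>x. m x a))"

definition countably_pracompact :: "'a topology \<Rightarrow> bool" where
  "countably_pracompact X \<longleftrightarrow>
     (\<exists>D \<subseteq> topspace X. X closure_of D = topspace X \<and>
        (\<forall>S \<subseteq> D. infinite S \<longrightarrow> X derived_set_of S \<noteq> {}))"

text \<open>HOL cannot quantify over all types inside a definition, so the type \<open>'b\<close> of the points of
  the ambient space is a parameter; a theorem \<open>H_closed TYPE('b) X\<close> with \<open>'b\<close> a type variable
  covers all Hausdorff spaces. As \<open>X\<close> and \<open>Y\<close> live on different types, ``contained as a
  subspace'' is expressed by a topological embedding.\<close>

definition H_closed :: "'b itself \<Rightarrow> 'a topology \<Rightarrow> bool" where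
  "H_closed _ X \<longleftrightarrow>
     Hausdorff_space X \<and>
     (\<forall>(Y :: 'b topology) f. Hausdorff_space Y \<and> embedding_map X Y f \<longrightarrow> closedin Y (f ` topspace X))"

definition semiregular_space :: "'a topology \<Rightarrow> bool" where
  "semiregular_space X \<longleftrightarrow>
     (\<exists>\<B>. (\<forall>W\<in>\<B>. X interior_of (X closure_of W) = W) \<and>
          openin X = arbitrary union_of (\<lambda>W. W \<in> \<B>))"

lemma base_c_Int:
  assumes "V1 \<in> base_c L x" "V2 \<in> base_c L x"
  shows "V1 \<inter> V2 \<in> base_c L x"
proof -
  obtain F where F: "V1 = up L x - (\<Union>y\<in>F. up L y)" "finite F" "F \<subseteq> up L x - {x}"
    using assms(1) unfolding base_c_def by blast
  obtain G where G: "V2 = up L x - (\<Union>y\<in>G. up L y)" "finite G" "G \<subseteq> up L x - {x}"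
    using assms(2) unfolding base_c_def by blast
  have "V1 \<inter> V2 = up L x - (\<Union>y\<in>F \<union> G. up L y)" "finite (F \<union> G)" "F \<union> G \<subseteq> up L x - {x}"
    using F G by auto
  then show ?thesis unfolding base_c_def by blast
qed

lemma base_fc_Int:
  assumes "V1 \<in> base_fc L A x" "V2 \<in> base_fc L A x"
  shows "V1 \<inter> V2 \<in> base_fc L A x"
proof (cases "x = {}")
  case True
  let ?p = "\<lambda>a::'a. {a}"
  obtain U B where 1: "V1 = U - ?p ` B" "U \<in> base_c L {}" "B \<subseteq> L" "finite ((A - B) \<union> (B - A))"
    using assms(1) True unfolding base_fc_def by auto
  obtain U' B' where 2: "V2 = U' - ?p ` B'" "U' \<in> base_c L {}" "B' \<subseteq> L"
      "finite ((A - B') \<union> (B' - A))"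
    using assms(2) True unfolding base_fc_def by auto
  have eq: "V1 \<inter> V2 = (U \<inter> U') - ?p ` (B \<union> B')"
    using 1(1) 2(1) by auto
  have fin: "finite ((A - (B \<union> B')) \<union> ((B \<union> B') - A))"
    by (rule finite_subset[of _ "((A - B) \<union> (B - A)) \<union> ((A - B') \<union> (B' - A))"])
       (use 1(4) 2(4) in auto)
  have "B \<union> B' \<subseteq> L" "U \<inter> U' \<in> base_c L {}"
    using 1 2 base_c_Int by blast+
  then have "\<exists>U B. V1 \<inter> V2 = U - ?p ` B \<and> U \<in> base_c L {} \<and> B \<subseteq> L \<and> finite ((A - B) \<union> (B - A))"
    using eq fin by blast
  with True show ?thesis unfolding base_fc_def by simp
next
  case False
  then show ?thesis using assms base_c_Int unfolding base_fc_def by auto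
qed

lemma up_in_base_c: "up L x \<in> base_c L x"
  unfolding base_c_def by (intro CollectI exI[of _ "{}"]) auto

lemma base_fc_nonempty:
  assumes "A \<subseteq> L"
  shows "base_fc L A x \<noteq> {}"
proof (cases "x = {}")
  case True
  then have "up L {} - (\<lambda>a. {a}) ` A \<in> base_fc L A x"
    unfolding base_fc_def
    by (simp, intro exI[of _ "up L {}"] exI[of _ A]) (use up_in_base_c[of L "{}"] assms in simp)
  then show ?thesis by blast
next
  case False
  then show ?thesis using up_in_base_c[of L x] unfolding base_fc_def by auto
qed

lemma base_fc_subset: "V \<in> base_fc L A x \<Longrightarrow> V \<subseteq> exp2 L"
  unfolding base_fc_def base_c_def up_def by (auto split: if_splits)

lemma istopology_fc:
  "istopology (\<lambda>U. U \<subseteq> exp2 L \<and> (\<forall>x\<in>U. \<exists>V\<in>base_fc L A x. V \<subseteq> U))"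
proof -
  have "\<exists>V\<in>base_fc L A x. V \<subseteq> S \<inter> T"
    if "\<exists>V\<in>base_fc L A x. V \<subseteq> S" "\<exists>V\<in>base_fc L A x. V \<subseteq> T" for S T x
    using that base_fc_Int[of _ L A x] by (meson Int_mono)
  then show ?thesis
    unfolding istopology_def by (simp add: Sup_le_iff le_infI1) (meson Sup_upper order_trans)
qed

lemma openin_tau_fc:
  "openin (tau_fc L A) U \<longleftrightarrow> U \<subseteq> exp2 L \<and> (\<forall>x\<in>U. \<exists>V\<in>base_fc L A x. V \<subseteq> U)"
  unfolding tau_fc_def topology_inverse'[OF istopology_fc] ..

lemma topspace_tau_fc:
  assumes "A \<subseteq> L"
  shows "topspace (tau_fc L A) = exp2 L"
proof
  have "openin (tau_fc L A) (exp2 L)"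
    unfolding openin_tau_fc using base_fc_nonempty[OF assms] base_fc_subset by fastforce
  then show "exp2 L \<subseteq> topspace (tau_fc L A)" by (rule openin_subset)
  show "topspace (tau_fc L A) \<subseteq> exp2 L"
    using openin_tau_fc openin_topspace by blast
qed

lemma base_fc_mem:
  assumes "x \<in> exp2 L" "V \<in> base_fc L A x"
  shows "x \<in> V"
  using assms unfolding base_fc_def base_c_def up_def by (auto split: if_splits)

lemma base_c_up_Int:
  assumes V: "V \<in> base_c L x" and y: "y \<in> V"
  shows "\<exists>W\<in>base_c L y. W \<subseteq> V"
proof -
  obtain F where F: "V = up L x - (\<Union>z\<in>F. up L z)" "finite F" "F \<subseteq> up L x - {x}"
    using V unfolding base_c_def by blast
  define G where "G = (\<lambda>z. z \<union> y) ` F \<inter> exp2 L"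
  have "y \<notin> G"
    using y F unfolding G_def up_def by auto
  then have G: "finite G" "G \<subseteq> up L y - {y}"
    using F(2) unfolding G_def up_def by auto
  have "up L y - (\<Union>z\<in>G. up L z) \<subseteq> V"
  proof
    fix w assume w: "w \<in> up L y - (\<Union>z\<in>G. up L z)"
    have "x \<subseteq> y" using y F(1) unfolding up_def by auto
    moreover have "w \<notin> up L z" if "z \<in> F" for z
    proof
      assume "w \<in> up L z"
      then have sub: "z \<union> y \<subseteq> w" and wL: "w \<subseteq> L" "finite w" "card w \<le> 2"
        using w unfolding up_def exp2_def by auto
      then have "z \<union> y \<in> exp2 L"
        unfolding exp2_def using card_mono[OF wL(2) sub] finite_subset[OF sub] by auto
      then have "z \<union> y \<in> G" using that unfolding G_def by blast
      then show False using w sub unfolding up_def by blast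
    qed
    ultimately show "w \<in> V" using w F(1) unfolding up_def by auto
  qed
  moreover have "up L y - (\<Union>z\<in>G. up L z) \<in> base_c L y"
    using G unfolding base_c_def by blast
  ultimately show ?thesis by blast
qed

lemma base_fc_open:
  assumes "V \<in> base_fc L A x"
  shows "openin (tau_fc L A) V"
  unfolding openin_tau_fc
proof (intro conjI ballI)
  show "V \<subseteq> exp2 L" using assms by (rule base_fc_subset)
  fix y assume y: "y \<in> V"
  show "\<exists>W\<in>base_fc L A y. W \<subseteq> V"
  proof (cases "y = {}")
    case True
    have "x = {}"
      using assms y True unfolding base_fc_def base_c_def up_def by (auto split: if_splits)
    then show ?thesis using assms True by blast
  next
    case False
    show ?thesis
    proof (cases "x = {}")
      case True
      obtain U B where UB: "V = U - (\<lambda>a. {a}) ` B" "U \<in> base_c L {}"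
        using assms True unfolding base_fc_def by auto
      obtain W where W: "W \<in> base_c L y" "W \<subseteq> U"
        using base_c_up_Int[OF UB(2), of y] y UB(1) by blast
      have "{a} \<notin> W" if "a \<in> B" for a
      proof
        assume a: "{a} \<in> W"
        then have "y \<subseteq> {a}" using W(1) unfolding base_c_def up_def by auto
        then have "y = {a}" using False by blast
        then show False using y UB(1) that by blast
      qed
      then have "W \<subseteq> V" using W(2) UB(1) by blast
      then show ?thesis using W(1) False unfolding base_fc_def by auto
    next
      case xne: False
      then show ?thesis
        using base_c_up_Int[of V L x y] assms y False unfolding base_fc_def by auto
    qed
  qed
qed

lemma base_fc_neighbourhood_base:
  assumes "openin (tau_fc L A) U" "x \<in> U"
  shows "\<exists>V\<in>base_fc L A x. openin (tau_fc L A) V \<and> x \<in> V \<and> V \<subseteq> U"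
  using assms base_fc_open base_fc_mem openin_tau_fc by (metis subsetD)

end

theory Submission
  imports Defs
begin

text \<open>The families \<open>base_c L x\<close> generate the topology that \<open>exp2 L\<close> inherits from the Cantor cube
  on \<open>L\<close>, in which it is compact. The topology \<open>tau_fc L A\<close> refines it at the single point zero, by
  allowing the removal of singletons along a set almost equal to \<open>A\<close>. Three observations
  give everything.

  Since the refinement keeps the old open sets, every set \<open>up L {a}\<close> stays clopen. These sets
  separate points, and a translation \<open>x \<mapsto> c \<inter> x\<close> is constant on each cell of the partition cut out
  by the finitely many of them with \<open>a \<in> c\<close>; hence the space is Hausdorff and the operation is
  separately continuous.

  Away from zero nothing has changed. Pairs are isolated, a neighbourhood of \<open>{a}\<close> contains all but
  finitely many members of \<open>up L {a}\<close>, and therefore each \<open>up L x\<close> with \<open>x\<close> non-zero is compact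
  (\<open>compactin_up\<close>). The pairs form a dense set that avoids the removed singletons, and on it an
  infinite subset clusters as it does in the compact coarse topology.

  The refinement at zero is not seen by closures: the removed singletons are limits of pairs that
  stay, so the closure of a neighbourhood of zero contains a coarse one
  (\<open>base_fc_zero_closure\<close>). Consequently, the closure of a neighbourhood of zero misses only part of
  a finite union of compact sets \<open>up L x\<close>, which gives \<open>H\<close>-closedness; and a regular open set
  around zero contains a coarse neighbourhood, hence \<open>{a}\<close> for almost all \<open>a\<close>, and so cannot fit
  inside the open set that omits \<open>{a}\<close> for the infinitely many \<open>a \<in> A\<close>.\<close>

section \<open>Clopen upper sets\<close>

lemma compl_up_in_base_c_zero:
  assumes "x \<in> exp2 L" "x \<noteq> {}"
  shows "exp2 L - up L x \<in> base_c L {}"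
proof -
  have "exp2 L - up L x = up L {} - (\<Union>y\<in>{x}. up L y)" "{x} \<subseteq> up L {} - {{}}"
    using assms unfolding up_def by auto
  then show ?thesis
    unfolding base_c_def by blast
qed

text \<open>Only at zero do the two bases differ, and there deleting the singletons over \<open>A\<close> turns a
  member of \<open>base_c\<close> into a smaller member of \<open>base_fc\<close>.\<close>

lemma base_c_openin_tau_fc:
  assumes "A \<subseteq> L" and V: "V \<in> base_c L x"
  shows "openin (tau_fc L A) V"
  unfolding openin_tau_fc
proof (intro conjI ballI)
  show "V \<subseteq> exp2 L"
    using V unfolding base_c_def up_def by auto
  fix y assume y: "y \<in> V"
  show "\<exists>W\<in>base_fc L A y. W \<subseteq> V"
  proof (cases "y = {}")
    case True
    with y V have "x = {}"
      unfolding base_c_def up_def by auto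
    then have "\<exists>U B. V - (\<lambda>a. {a}) ` A = U - (\<lambda>a. {a}) ` B \<and> U \<in> base_c L {} \<and> B \<subseteq> L
        \<and> finite ((A - B) \<union> (B - A))"
      using assms by (intro exI[of _ V] exI[of _ A]) auto
    then have "V - (\<lambda>a. {a}) ` A \<in> base_fc L A y"
      using True unfolding base_fc_def by simp
    then show ?thesis by blast
  next
    case False
    then show ?thesis
      using base_c_up_Int[OF V y] unfolding base_fc_def by simp
  qed
qed

lemma openin_up: "A \<subseteq> L \<Longrightarrow> openin (tau_fc L A) (up L x)"
  by (rule base_c_openin_tau_fc[OF _ up_in_base_c])

lemma openin_compl_up:
  assumes "A \<subseteq> L" "x \<in> exp2 L"
  shows "openin (tau_fc L A) (exp2 L - up L x)"
proof (cases "x = {}")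
  case True
  then have "exp2 L - up L x = {}"
    unfolding up_def by auto
  then show ?thesis
    by (metis openin_empty)
next
  case False
  then show ?thesis
    using assms by (intro base_c_openin_tau_fc[OF _ compl_up_in_base_c_zero])
qed

lemma singleton_in_exp2: "a \<in> L \<Longrightarrow> {a} \<in> exp2 L"
  unfolding exp2_def by simp

lemma mem_up_singleton: "y \<in> up L {a} \<longleftrightarrow> y \<in> exp2 L \<and> a \<in> y"
  unfolding up_def by auto

section \<open>The Hausdorff property and separate continuity\<close>

text \<open>Distinct points differ in some element \<open>a\<close>, and the clopen set \<open>up L {a}\<close> separates them.\<close>

lemma Hausdorff_space_tau_fc:
  assumes "A \<subseteq> L"
  shows "Hausdorff_space (tau_fc L A)"
proof -
  have separated: "\<exists>U V. openin (tau_fc L A) U \<and> openin (tau_fc L A) V \<and> x \<in> U \<and> y \<in> V \<and> disjnt U V"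
    if "x \<in> exp2 L" "y \<in> exp2 L" "a \<in> x" "a \<notin> y" for x y a
  proof -
    have "a \<in> L"
      using that unfolding exp2_def by blast
    then show ?thesis
      using openin_up[OF assms, of "{a}"] openin_compl_up[OF assms singleton_in_exp2, of a] that
      by (intro exI[of _ "up L {a}"] exI[of _ "exp2 L - up L {a}"])
        (auto simp: mem_up_singleton disjnt_def)
  qed
  show ?thesis
    unfolding Hausdorff_space_def topspace_tau_fc[OF assms]
  proof (intro allI impI)
    fix x y assume xy: "x \<in> exp2 L \<and> y \<in> exp2 L \<and> x \<noteq> y"
    then consider a where "a \<in> x" "a \<notin> y" | a where "a \<in> y" "a \<notin> x"
      by blast
    then show "\<exists>U V. openin (tau_fc L A) U \<and> openin (tau_fc L A) V \<and> x \<in> U \<and> y \<in> V \<and> disjnt U V"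
    proof cases
      case 1
      then show ?thesis using separated xy by blast
    next
      case 2
      then show ?thesis using separated[of y x] xy by (meson disjnt_sym)
    qed
  qed
qed

text \<open>The trace \<open>c \<inter> x\<close> depends only on which of the finitely many clopen sets \<open>up L {a}\<close>,
  \<open>a \<in> c\<close>, contain \<open>x\<close>; so the translation is locally constant.\<close>

lemma continuous_map_Int_tau_fc:
  assumes "A \<subseteq> L" and c: "c \<in> exp2 L"
  shows "continuous_map (tau_fc L A) (tau_fc L A) (\<lambda>x. c \<inter> x)"
proof -
  have Int_exp2: "c \<inter> x \<in> exp2 L" for x
    using c card_mono[of c "c \<inter> x"] unfolding exp2_def by auto
  have nhd: "\<exists>T. openin (tau_fc L A) T \<and> x \<in> T \<and> (\<forall>y\<in>T. c \<inter> y = c \<inter> x)"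
    if x: "x \<in> exp2 L" for x
  proof -
    define E where "E a = (if a \<in> x then up L {a} else exp2 L - up L {a})" for a
    define T where "T = (\<Inter>a\<in>c. E a) \<inter> exp2 L"
    have "openin (tau_fc L A) (E a)" if "a \<in> c" for a
    proof -
      have "a \<in> L"
        using that c unfolding exp2_def by blast
      then show ?thesis
        unfolding E_def
        using openin_up[OF assms(1), of "{a}"] openin_compl_up[OF assms(1) singleton_in_exp2, of a]
        by simp
    qed
    then have "openin (tau_fc L A) T"
      unfolding T_def topspace_tau_fc[OF assms(1), symmetric]
      using c by (intro openin_INT) (auto simp: exp2_def)
    moreover have "x \<in> T"
      using x unfolding T_def E_def by (auto simp: mem_up_singleton)
    moreover have "c \<inter> y = c \<inter> x" if "y \<in> T" for y
    proof -
      have "a \<in> y \<longleftrightarrow> a \<in> x" if "a \<in> c" for a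
      proof -
        have "y \<in> E a"
          using \<open>y \<in> T\<close> \<open>a \<in> c\<close> unfolding T_def by blast
        then show ?thesis
          unfolding E_def by (auto simp: mem_up_singleton split: if_splits)
      qed
      then show ?thesis by blast
    qed
    ultimately show ?thesis by blast
  qed
  show ?thesis
    unfolding continuous_map topspace_tau_fc[OF assms(1)]
  proof (intro conjI allI impI)
    show "(\<inter>) c ` exp2 L \<subseteq> exp2 L"
      using Int_exp2 by blast
    fix U assume "openin (tau_fc L A) U"
    show "openin (tau_fc L A) {x \<in> exp2 L. c \<inter> x \<in> U}"
      unfolding openin_subopen[of _ "{x \<in> exp2 L. c \<inter> x \<in> U}"]
    proof
      fix x assume x: "x \<in> {x \<in> exp2 L. c \<inter> x \<in> U}"
      then obtain T where T: "openin (tau_fc L A) T" "x \<in> T" "\<forall>y\<in>T. c \<inter> y = c \<inter> x"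
        using nhd by blast
      have "T \<subseteq> {x \<in> exp2 L. c \<inter> x \<in> U}"
      proof
        fix y assume y: "y \<in> T"
        have "y \<in> exp2 L"
          using y openin_subset[OF T(1)] topspace_tau_fc[OF assms(1)] by auto
        moreover have "c \<inter> y = c \<inter> x"
          using T(3) y by blast
        ultimately show "y \<in> {x \<in> exp2 L. c \<inter> x \<in> U}"
          using x by simp
      qed
      then show "\<exists>T. openin (tau_fc L A) T \<and> x \<in> T \<and> T \<subseteq> {x \<in> exp2 L. c \<inter> x \<in> U}"
        using T(1,2) by blast
    qed
  qed
qed

lemma semitopological_semilattice_tau_fc:
  assumes "A \<subseteq> L"
  shows "semitopological_semilattice (tau_fc L A) (\<inter>)"
proof -
  have "x \<inter> y \<in> exp2 L" if "x \<in> exp2 L" for x y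
    using that card_mono[of x "x \<inter> y"] unfolding exp2_def by auto
  moreover have "continuous_map (tau_fc L A) (tau_fc L A) (\<lambda>x. x \<inter> c)" if "c \<in> exp2 L" for c
    using continuous_map_Int_tau_fc[OF assms that] by (simp add: Int_commute)
  ultimately show ?thesis
    unfolding semitopological_semilattice_def topspace_tau_fc[OF assms]
    using continuous_map_Int_tau_fc[OF assms] by (auto simp: Int_assoc Int_commute)
qed

section \<open>Neighbourhoods of non-zero points\<close>

text \<open>Above a non-zero point \<open>x\<close> every proper extension has exactly two elements and is maximal,
  so a basic neighbourhood of \<open>x\<close> leaves out only the finitely many extensions removed from it.\<close>

lemma finite_up_minus_base_c:
  assumes "V \<in> base_c L x" "x \<noteq> {}"
  shows "finite (up L x - V)"
proof -
  obtain F where F: "V = up L x - (\<Union>y\<in>F. up L y)" "finite F" "F \<subseteq> up L x - {x}"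
    using assms(1) unfolding base_c_def by blast
  have "z = y" if "y \<in> F" "z \<in> up L y" for y z
  proof -
    have sub: "x \<subset> y" "y \<subseteq> z" and z: "finite z" "card z \<le> 2" and "finite y"
      using that F(3) unfolding up_def exp2_def by auto
    then have "card x < card y" "0 < card x"
      using assms(2) psubset_card_mono[of y x] finite_subset[of x y] by (auto simp: card_gt_0_iff)
    then show ?thesis
      using card_subset_eq[OF z(1) sub(2)] card_mono[OF z(1) sub(2)] z(2) by auto
  qed
  then have "up L x - V \<subseteq> F"
    using F(1) by blast
  then show ?thesis
    using F(2) finite_subset by blast
qed

lemma finite_up_minus_open:
  assumes "openin (tau_fc L A) T" "x \<in> T" "x \<noteq> {}"
  shows "finite (up L x - T)"
proof -
  have "base_fc L A x = base_c L x"
    using assms(3) unfolding base_fc_def by simp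
  moreover have "\<exists>V\<in>base_fc L A x. V \<subseteq> T"
    using assms(1,2) unfolding openin_tau_fc by blast
  ultimately obtain V where V: "V \<in> base_c L x" "V \<subseteq> T"
    by auto
  show ?thesis
    by (rule finite_subset[OF _ finite_up_minus_base_c[OF V(1) assms(3)]]) (use V(2) in blast)
qed

lemma compactin_up:
  assumes "A \<subseteq> L" "x \<in> exp2 L" "x \<noteq> {}"
  shows "compactin (tau_fc L A) (up L x)"
  unfolding compactin_def topspace_tau_fc[OF assms(1)]
proof (intro conjI allI impI)
  show "up L x \<subseteq> exp2 L"
    unfolding up_def by auto
  fix \<U> assume \<U>: "Ball \<U> (openin (tau_fc L A)) \<and> up L x \<subseteq> \<Union>\<U>"
  have "x \<in> up L x"
    using assms(2) unfolding up_def by simp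
  then obtain T where T: "T \<in> \<U>" "x \<in> T"
    using \<U> by blast
  then have "finite (up L x - T)"
    using \<U> finite_up_minus_open[OF _ _ assms(3)] by blast
  moreover have "up L x - T \<subseteq> \<Union>\<U>"
    using \<U> by blast
  ultimately obtain \<G> where "finite \<G>" "\<G> \<subseteq> \<U>" "up L x - T \<subseteq> \<Union>\<G>"
    by (meson finite_subset_Union)
  then show "\<exists>\<F>. finite \<F> \<and> \<F> \<subseteq> \<U> \<and> up L x \<subseteq> \<Union>\<F>"
    using T(1) by (intro exI[of _ "insert T \<G>"]) auto
qed

lemma open_singleton_contains_pair:
  assumes "infinite L" "openin (tau_fc L A) T" "{a} \<in> T"
  shows "\<exists>c\<in>L. c \<noteq> a \<and> {a, c} \<in> T"
proof -
  have "{a} \<in> exp2 L"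
    using assms(2,3) unfolding openin_tau_fc by blast
  then have pairs: "(\<lambda>c. {a, c}) ` (L - {a}) \<subseteq> up L {a}"
    unfolding up_def exp2_def by (auto simp: card_insert_if)
  have "inj_on (\<lambda>c. {a, c}) (L - {a})"
    by (auto simp: inj_on_def doubleton_eq_iff)
  then have "infinite ((\<lambda>c. {a, c}) ` (L - {a}))"
    using assms(1) by (simp add: finite_image_iff)
  moreover have "finite (up L {a} - T)"
    using finite_up_minus_open assms(2,3) by blast
  ultimately have "\<not> (\<lambda>c. {a, c}) ` (L - {a}) \<subseteq> up L {a} - T"
    using finite_subset by blast
  then show ?thesis
    using pairs by blast
qed

section \<open>Neighbourhoods of zero\<close>

text \<open>Removing singletons from a basic neighbourhood of zero is invisible to the closure, because
  each removed \<open>{b}\<close> is a limit of pairs \<open>{b, c}\<close>, none of which is removed. This is the source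
  of both the \<open>H\<close>-closedness and the failure of semiregularity.\<close>

lemma base_fc_zero_closure:
  assumes "infinite L" "A \<subseteq> L" "V \<in> base_fc L A {}"
  obtains U where "U \<in> base_c L {}" "V \<subseteq> U" "U \<subseteq> tau_fc L A closure_of V"
proof -
  obtain U B where UB: "V = U - (\<lambda>a. {a}) ` B" "U \<in> base_c L {}"
    using assms(3) unfolding base_fc_def by auto
  have U: "openin (tau_fc L A) U"
    using base_c_openin_tau_fc[OF assms(2) UB(2)] .
  then have "V \<subseteq> topspace (tau_fc L A)"
    using UB(1) openin_subset by blast
  then have V: "V \<subseteq> tau_fc L A closure_of V"
    by (rule closure_of_subset)
  have "{b} \<in> tau_fc L A closure_of V" if "{b} \<in> U" for b
    unfolding in_closure_of
  proof (intro conjI allI impI)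
    show "{b} \<in> topspace (tau_fc L A)"
      using that openin_subset[OF U] by blast
    fix T assume "{b} \<in> T \<and> openin (tau_fc L A) T"
    then have "openin (tau_fc L A) (T \<inter> U)" "{b} \<in> T \<inter> U"
      using U that by auto
    then obtain c where "c \<noteq> b" "{b, c} \<in> T \<inter> U"
      using open_singleton_contains_pair[OF assms(1)] by blast
    then show "\<exists>y. y \<in> V \<and> y \<in> T"
      unfolding UB(1) by (intro exI[of _ "{b, c}"]) auto
  qed
  then have "U \<subseteq> tau_fc L A closure_of V"
    using V UB(1) by blast
  then show thesis
    using that UB by blast
qed

lemma finite_singletons_outside_base_c_zero:
  assumes "U \<in> base_c L {}"
  shows "finite {a \<in> L. {a} \<notin> U}"
proof -
  obtain F where F: "U = up L {} - (\<Union>y\<in>F. up L y)" "finite F" "F \<subseteq> up L {} - {{}}"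
    using assms unfolding base_c_def by blast
  have "{a} \<in> F" if a: "a \<in> L" "{a} \<notin> U" for a
  proof -
    have "{a} \<in> up L {}"
      using singleton_in_exp2[OF a(1)] unfolding up_def by simp
    then obtain y where y: "y \<in> F" "{a} \<in> up L y"
      using a(2) F(1) by blast
    then have "y = {a}"
      using F(3) unfolding up_def by auto
    then show ?thesis using y(1) by simp
  qed
  then have "(\<lambda>a. {a}) ` {a \<in> L. {a} \<notin> U} \<subseteq> F"
    by blast
  then have "finite ((\<lambda>a. {a}) ` {a \<in> L. {a} \<notin> U})"
    using F(2) finite_subset by blast
  then show ?thesis
    by (rule finite_imageD) simp
qed

section \<open>Countable pracompactness\<close>

text \<open>The dense set is the set of pairs. An infinite set of pairs either has infinitely many
  members through one element \<open>a\<close>, and then clusters at \<open>{a}\<close>, or only finitely many members in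
  every \<open>up L {a}\<close>, and then clusters at zero: the pairs removed from the whole space by a basic
  neighbourhood of zero lie in finitely many sets \<open>up L y\<close>, each contained in some \<open>up L {a}\<close>.\<close>

lemma countably_pracompact_tau_fc:
  assumes "infinite L" "A \<subseteq> L"
  shows "countably_pracompact (tau_fc L A)"
proof -
  define D where "D = {x \<in> exp2 L. card x = 2}"
  have pair_D: "{a, c} \<in> D" if "{a, c} \<in> exp2 L" "c \<noteq> a" for a c
    using that unfolding D_def by simp
  have D_cases: "x = {} \<or> (\<exists>a\<in>L. x = {a}) \<or> x \<in> D" if "x \<in> exp2 L" for x
  proof -
    have x: "card x \<le> 2" "finite x" "x \<subseteq> L"
      using that unfolding exp2_def by auto
    from x(1) have "card x = 0 \<or> card x = 1 \<or> card x = 2"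
      by linarith
    with x(2,3) show ?thesis
      using that unfolding D_def by (auto simp: card_1_singleton_iff)
  qed
  have "x \<in> tau_fc L A closure_of D" if x: "x \<in> exp2 L" for x
    unfolding in_closure_of topspace_tau_fc[OF assms(2)]
  proof (intro conjI allI impI)
    show "x \<in> exp2 L" by (rule x)
    fix T assume T: "x \<in> T \<and> openin (tau_fc L A) T"
    then have T_sub: "T \<subseteq> exp2 L"
      using openin_tau_fc by blast
    from D_cases[OF x] consider "x = {}" | a where "a \<in> L" "x = {a}" | "x \<in> D"
      by blast
    then show "\<exists>y. y \<in> D \<and> y \<in> T"
    proof cases
      case 1
      then obtain V where V: "V \<in> base_fc L A {}" "V \<subseteq> T"
        using T unfolding openin_tau_fc by blast
      then obtain U B where UB: "V = U - (\<lambda>a. {a}) ` B" "U \<in> base_c L {}"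
        unfolding base_fc_def by auto
      have "\<not> L \<subseteq> {a \<in> L. {a} \<notin> U}"
        using finite_singletons_outside_base_c_zero[OF UB(2)] assms(1) finite_subset by blast
      then obtain a where "{a} \<in> U"
        by blast
      then obtain c where c: "c \<noteq> a" "{a, c} \<in> U"
        using open_singleton_contains_pair[OF assms(1) base_c_openin_tau_fc[OF assms(2) UB(2)]]
        by blast
      then have "{a, c} \<in> T"
        using UB(1) V(2) by auto
      then show ?thesis
        using pair_D c(1) T_sub by blast
    next
      case 2
      then show ?thesis
        using open_singleton_contains_pair[OF assms(1), of A T] T T_sub pair_D by blast
    next
      case 3
      then show ?thesis using T by blast
    qed
  qed
  then have dense: "tau_fc L A closure_of D = exp2 L"
    using closure_of_subset_topspace[of "tau_fc L A" D] topspace_tau_fc[OF assms(2)] by blast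
  have accumulates: "tau_fc L A derived_set_of S \<noteq> {}" if S: "S \<subseteq> D" "infinite S" for S
  proof (cases "\<exists>a\<in>L. infinite (S \<inter> up L {a})")
    case True
    then obtain a where a: "a \<in> L" "infinite (S \<inter> up L {a})"
      by blast
    have "{a} \<in> tau_fc L A derived_set_of S"
      unfolding in_derived_set_of topspace_tau_fc[OF assms(2)]
    proof (intro conjI allI impI)
      show "{a} \<in> exp2 L"
        using a(1) by (rule singleton_in_exp2)
      fix T assume "{a} \<in> T \<and> openin (tau_fc L A) T"
      then have "finite (up L {a} - T)"
        using finite_up_minus_open by blast
      then have "\<not> S \<inter> up L {a} \<subseteq> up L {a} - T"
        using a(2) finite_subset by blast
      then obtain y where "y \<in> S" "y \<in> T"
        by blast
      moreover from \<open>y \<in> S\<close> have "y \<noteq> {a}"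
        using S(1) unfolding D_def by auto
      ultimately show "\<exists>y. y \<noteq> {a} \<and> y \<in> S \<and> y \<in> T"
        by blast
    qed
    then show ?thesis by blast
  next
    case False
    have "{} \<in> tau_fc L A derived_set_of S"
      unfolding in_derived_set_of topspace_tau_fc[OF assms(2)]
    proof (intro conjI allI impI)
      show "{} \<in> exp2 L"
        unfolding exp2_def by simp
      fix T assume "{} \<in> T \<and> openin (tau_fc L A) T"
      then obtain V where V: "V \<in> base_fc L A {}" "V \<subseteq> T"
        unfolding openin_tau_fc by blast
      then obtain U B where UB: "V = U - (\<lambda>a. {a}) ` B" "U \<in> base_c L {}"
        unfolding base_fc_def by auto
      obtain F where F: "U = up L {} - (\<Union>y\<in>F. up L y)" "finite F" "F \<subseteq> up L {} - {{}}"
        using UB(2) unfolding base_c_def by blast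
      have "finite (S \<inter> up L y)" if y: "y \<in> F" for y
      proof -
        obtain a where "a \<in> y" "a \<in> L"
          using F(3) y unfolding up_def exp2_def by blast
        then have "S \<inter> up L y \<subseteq> S \<inter> up L {a}" "finite (S \<inter> up L {a})"
          using False unfolding up_def by auto
        then show ?thesis by (rule finite_subset)
      qed
      then have "finite (\<Union>y\<in>F. S \<inter> up L y)"
        using F(2) by blast
      then have "\<not> S \<subseteq> (\<Union>y\<in>F. S \<inter> up L y)"
        using S(2) finite_subset by blast
      then obtain s where s: "s \<in> S" "s \<notin> (\<Union>y\<in>F. up L y)"
        by blast
      have "s \<in> D"
        using s(1) S(1) by blast
      then have "s \<in> up L {}" "s \<notin> (\<lambda>a. {a}) ` B" "s \<noteq> {}"
        unfolding D_def up_def by auto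
      then have "s \<in> T"
        using s(2) F(1) UB(1) V(2) by blast
      then show "\<exists>y. y \<noteq> {} \<and> y \<in> S \<and> y \<in> T"
        using s(1) \<open>s \<noteq> {}\<close> by blast
    qed
    then show ?thesis by blast
  qed
  have "D \<subseteq> exp2 L"
    unfolding D_def by blast
  then show ?thesis
    unfolding countably_pracompact_def topspace_tau_fc[OF assms(2)]
    using dense accumulates by (intro exI[of _ D]) blast
qed

section \<open>H-closedness\<close>

text \<open>The closure of \<open>W\<close> contains a member of \<open>base_c L {}\<close>, whose complement is a finite union of
  compact sets \<open>up L y\<close>.\<close>

lemma exp2_subset_closure_Un_compact:
  assumes "infinite L" "A \<subseteq> L" "openin (tau_fc L A) W" "{} \<in> W"
  obtains K where "compactin (tau_fc L A) K" "exp2 L \<subseteq> tau_fc L A closure_of W \<union> K"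
proof -
  obtain V where V: "V \<in> base_fc L A {}" "V \<subseteq> W"
    using assms(3,4) unfolding openin_tau_fc by blast
  obtain U where U: "U \<in> base_c L {}" "U \<subseteq> tau_fc L A closure_of V"
    by (rule base_fc_zero_closure[OF assms(1,2) V(1)])
  obtain F where F: "U = up L {} - (\<Union>y\<in>F. up L y)" "finite F" "F \<subseteq> up L {} - {{}}"
    using U(1) unfolding base_c_def by blast
  have "compactin (tau_fc L A) (\<Union>y\<in>F. up L y)"
  proof (rule compactin_Union)
    show "compactin (tau_fc L A) K" if "K \<in> up L ` F" for K
      using that F(3) compactin_up[OF assms(2)] unfolding up_def[of L "{}"] by blast
  qed (use F(2) in simp)
  moreover have "U \<subseteq> tau_fc L A closure_of W"
    using U(2) closure_of_mono[OF V(2)] by blast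
  then have "exp2 L \<subseteq> tau_fc L A closure_of W \<union> (\<Union>y\<in>F. up L y)"
    using F(1) unfolding up_def[of L "{}"] by blast
  ultimately show thesis
    using that by blast
qed

text \<open>A point \<open>q\<close> outside the image of an embedding is separated from the image of zero by disjoint
  open sets. The one around \<open>q\<close> also misses the image of the closure of the other, so what it
  meets of the image lies in the image of a compact set, which is closed and can be removed.\<close>

lemma H_closed_tau_fc:
  fixes L A :: "'a set"
  assumes "infinite L" "A \<subseteq> L"
  shows "H_closed TYPE('b) (tau_fc L A)"
  unfolding H_closed_def
proof (intro conjI allI impI)
  show "Hausdorff_space (tau_fc L A)"
    by (rule Hausdorff_space_tau_fc[OF assms(2)])
  fix Y :: "'b topology" and f
  let ?X = "tau_fc L A"
  assume Y: "Hausdorff_space Y \<and> embedding_map ?X Y f"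
  then have f: "continuous_map ?X Y f"
    unfolding embedding_map_def homeomorphic_eq_everything_map
    by (metis continuous_map_into_fulltopology)
  have top: "topspace ?X = exp2 L"
    by (rule topspace_tau_fc[OF assms(2)])
  have zero: "{} \<in> exp2 L"
    unfolding exp2_def by simp
  have image: "f ` topspace ?X \<subseteq> topspace Y"
    using f continuous_map_image_subset_topspace by blast
  have "\<exists>T. openin Y T \<and> q \<in> T \<and> T \<subseteq> topspace Y - f ` topspace ?X"
    if q: "q \<in> topspace Y - f ` topspace ?X" for q
  proof -
    have "f {} \<in> topspace Y" "f {} \<noteq> q"
      using image q zero top by auto
    then obtain P Q where PQ: "openin Y P" "openin Y Q" "f {} \<in> P" "q \<in> Q" "disjnt P Q"
      using Y q unfolding Hausdorff_space_def by blast
    define W where "W = {x \<in> topspace ?X. f x \<in> P}"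
    define Z where "Z = {x \<in> topspace ?X. f x \<in> Q}"
    have W: "openin ?X W" and Z: "openin ?X Z"
      unfolding W_def Z_def using f PQ openin_continuous_map_preimage by blast+
    have "{} \<in> W"
      using PQ(3) zero top unfolding W_def by simp
    then obtain K where K: "compactin ?X K" "exp2 L \<subseteq> ?X closure_of W \<union> K"
      using exp2_subset_closure_Un_compact[OF assms W] by blast
    have "Z \<inter> W = {}"
      using PQ(5) unfolding W_def Z_def disjnt_def by blast
    then have "Z \<inter> ?X closure_of W = {}"
      using openin_Int_closure_of_eq_empty[OF Z] by blast
    then have "Z \<subseteq> K"
      using K(2) unfolding Z_def top by blast
    have "compactin Y (f ` K)"
      using image_compactin[OF K(1) f] .
    then have "closedin Y (f ` K)"
      using Y compactin_imp_closedin by blast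
    then have "openin Y (Q - f ` K)"
      using PQ(2) openin_diff by blast
    moreover have "q \<notin> f ` K"
      using q compactin_subset_topspace[OF K(1)] by blast
    moreover have "Q - f ` K \<subseteq> topspace Y - f ` topspace ?X"
      using \<open>Z \<subseteq> K\<close> openin_subset[OF PQ(2)] unfolding Z_def by blast
    ultimately show ?thesis
      using PQ(4) by blast
  qed
  then have "openin Y (topspace Y - f ` topspace ?X)"
    by (subst openin_subopen) blast
  then show "closedin Y (f ` topspace ?X)"
    unfolding closedin_def using image by blast
qed

section \<open>Failure of semiregularity\<close>

text \<open>A regular open set that contains zero contains, with a basic neighbourhood of zero, also the
  singletons that were removed from it, up to finitely many. So no regular open set fits between
  zero and the open set \<open>exp2 L - {{a} | a. a \<in> A}\<close>.\<close>

lemma not_semiregular_space_tau_fc: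
  assumes "A \<subseteq> L" "infinite A"
  shows "\<not> semiregular_space (tau_fc L A)"
proof
  let ?X = "tau_fc L A"
  have L: "infinite L"
    using assms finite_subset by blast
  assume "semiregular_space ?X"
  then obtain \<B> where reg: "\<forall>W\<in>\<B>. ?X interior_of (?X closure_of W) = W"
    and base: "openin ?X = arbitrary union_of (\<lambda>W. W \<in> \<B>)"
    unfolding semiregular_space_def by blast
  define N where "N = up L {} - (\<lambda>a. {a}) ` A"
  have "N \<in> base_fc L A {}"
    unfolding N_def base_fc_def
    by (simp, intro exI[of _ "up L {}"] exI[of _ A]) (use up_in_base_c[of L "{}"] assms in simp)
  then have "openin ?X N"
    by (rule base_fc_open)
  moreover have "{} \<in> N"
    unfolding N_def up_def exp2_def by auto
  ultimately obtain W where W: "W \<in> \<B>" "{} \<in> W" "W \<subseteq> N"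
    unfolding base union_of_def by auto
  have "openin ?X W"
    using reg W(1) openin_interior_of by metis
  then obtain V where V: "V \<in> base_fc L A {}" "V \<subseteq> W"
    using W(2) unfolding openin_tau_fc by blast
  obtain U where U: "U \<in> base_c L {}" "U \<subseteq> ?X closure_of V"
    by (rule base_fc_zero_closure[OF L assms(1) V(1)])
  have "U \<subseteq> ?X interior_of (?X closure_of W)"
    using interior_of_maximal[OF _ base_c_openin_tau_fc[OF assms(1) U(1)]]
      U(2) closure_of_mono[OF V(2)] by blast
  then have "U \<subseteq> N"
    using reg W(1,3) by blast
  then have "A \<subseteq> {a \<in> L. {a} \<notin> U}"
    using assms(1) unfolding N_def by blast
  then show False
    using finite_singletons_outside_base_c_zero[OF U(1)] assms(2) finite_subset by blast
qed

theorem proposition3: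
  fixes L A :: "'a set"
  assumes "infinite L" and "A \<subseteq> L" and "infinite A"
  shows "topspace (tau_fc L A) = exp2 L \<and>
         semitopological_semilattice (tau_fc L A) (\<inter>) \<and>
         countably_pracompact (tau_fc L A) \<and>
         H_closed TYPE('b) (tau_fc L A) \<and>
         \<not> semiregular_space (tau_fc L A)"
proof (intro conjI)
  show "topspace (tau_fc L A) = exp2 L"
    using assms(2) by (rule topspace_tau_fc)
  show "semitopological_semilattice (tau_fc L A) (\<inter>)"
    using assms(2) by (rule semitopological_semilattice_tau_fc)
  show "countably_pracompact (tau_fc L A)"
    using assms(1,2) by (rule countably_pracompact_tau_fc)
  show "H_closed TYPE('b) (tau_fc L A)"
    using assms(1,2) by (rule H_closed_tau_fc)
  show "\<not> semiregular_space (tau_fc L A)"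
    using assms(2,3) by (rule not_semiregular_space_tau_fc)
qed

end
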